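(* Let $r \geq 2$ be an integer and let $l$ be a positive integer. Let $m \geq 2$ and let $A=\{a_1, a_2, \dots, a_m\}$ be a set of integers with $a_1 < a_2 < \cdots < a_m$. Set $$d=\gcd(a_2-a_1, a_3-a_1, \dots, a_m-a_1).$$ 1. If $A$ is an asymptotic $(r,l)$-approximate group, then $l \geq r$. 2. If $A$ is an asymptotic $(r,r)$-approximate group, then $a_2=a_1+d$ and $a_m=a_{m-1}+d$.
   Context: For nonempty sets $S,T$ of integers, $S+T=\{s+t \mid s\in S,\ t\in T\}$. For a positive integer $h$ and a nonempty set $A$ of integers, the $h$-fold sumset is $hA=\{x_1+\cdots+x_h \mid x_i\in A \text{ for } i=1,\dots,h\}$ (repetitions allowed). For positive integers $r$ and $l$, a nonempty finite set $A$ of integers is an $(r,l)$-approximate group if there exists a set $X$ consisting of $l$ integers such that $rA \subseteq A+X$. The set $A$ is an asymptotic $(r,l)$-approximate group if there is an integer $h_0$ such that $hA$ is an $(r,l)$-approximate group for every positive integer $h\geq h_0$. *)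

theory Defs
  imports Main "HOL-Library.Set_Algebras"
begin

text \<open>The sumset \<open>S + T\<close> is the elementwise sum provided by \<open>HOL-Library.Set_Algebras\<close>.\<close>

definition sumset_fold :: "nat \<Rightarrow> int set \<Rightarrow> int set" where
  "sumset_fold h A = {\<Sum>i=1..h. x i | x :: nat \<Rightarrow> int. \<forall>i\<in>{1..h}. x i \<in> A}"

text \<open>The parameters \<open>r\<close> and \<open>l\<close> are meant to be positive.\<close>

definition approximate_group :: "nat \<Rightarrow> nat \<Rightarrow> int set \<Rightarrow> bool" where
  "approximate_group r l A \<longleftrightarrow> finite A \<and> A \<noteq> {} \<and>
     (\<exists>X :: int set. finite X \<and> card X = l \<and> sumset_fold r A \<subseteq> A + X)"

definition asymptotic_approximate_group :: "nat \<Rightarrow> nat \<Rightarrow> int set \<Rightarrow> bool" where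
  "asymptotic_approximate_group r l A \<longleftrightarrow> finite A \<and> A \<noteq> {} \<and>
     (\<exists>h\<^sub>0 :: nat. \<forall>h\<ge>h\<^sub>0. h > 0 \<longrightarrow> approximate_group r l (sumset_fold h A))"

end

theory Submission
  imports Defs
begin

text \<open>
  Write \<open>A = a\<^sub>1 + d \<cdot> B\<close>, where \<open>B \<subseteq> {0..N}\<close> contains \<open>0\<close> and \<open>N\<close> and has greatest common divisor
  1. Then \<open>hB\<close> lies in \<open>{0..hN}\<close>, and it contains the whole of \<open>{kN..(h-k)N}\<close>, where \<open>k\<close> does not
  depend on \<open>h\<close> (\<open>sumset_fold_contains_interval\<close>). The \<open>r\<close>-fold sumset of \<open>hB\<close> is \<open>rhB\<close>, so
  everything is about covering \<open>rhB\<close> by \<open>l\<close> translates of \<open>hB\<close>, with \<open>M = hN\<close> as large as needed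
  (\<open>approximate_group_affine_cover\<close> passes from \<open>A\<close> to \<open>B\<close>).

  The inequality \<open>l \<ge> r\<close> is a count: \<open>rhB\<close> has \<open>rM - O(1)\<close> elements and each translate has at most
  \<open>M + 1\<close>.

  Now let \<open>l = r\<close> and suppose that \<open>1 \<notin> B\<close>. Then no \<open>hB\<close> contains 1, so each translate \<open>x + hB\<close>
  has a hole at \<open>x + 1\<close>. Scan the translates from the right. The hole of the last one has to be
  filled by an earlier one, so it starts at most \<open>M - 1\<close> after its predecessor; repeating this down to
  a translate that covers 0, one finds that \<open>r\<close> translates reach at most \<open>r (M - 1) + 1\<close>
  (\<open>cover_by_punctured_translates\<close>), which is less than \<open>rM = max (rhB)\<close>. The argument uses
  only the two end points of \<open>rhB\<close> and its long interval, with the unknown parts between them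
  of bounded length.

  Thus \<open>1 \<in> B\<close>, that is, \<open>a\<^sub>1 + d \<in> A\<close>. For the reflected set \<open>N - B\<close>, which also
  describes \<open>A\<close>, with base point \<open>a\<^sub>m\<close> and step \<open>-d\<close>, the same result gives \<open>a\<^sub>m - d \<in> A\<close>.
  Since distinct elements of \<open>A\<close> differ by at least \<open>d\<close>, these two elements are \<open>a\<^sub>2\<close> and
  \<open>a\<^bsub>m-1\<^esub>\<close>.
\<close>

section \<open>Iterated sumsets\<close>

lemma sumset_fold_0 [simp]: "sumset_fold 0 A = {0}"
  by (auto simp: sumset_fold_def)

lemma sumset_fold_Suc: "sumset_fold (Suc h) A = sumset_fold h A + A"
proof (intro equalityI subsetI)
  fix z assume "z \<in> sumset_fold (Suc h) A"
  then obtain x where x: "\<forall>i\<in>{1..Suc h}. x i \<in> A" "z = (\<Sum>i=1..Suc h. x i)"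
    by (auto simp: sumset_fold_def)
  have "(\<Sum>i=1..h. x i) \<in> sumset_fold h A"
    using x(1) unfolding sumset_fold_def by force
  moreover have "x (Suc h) \<in> A" using x(1) by simp
  ultimately show "z \<in> sumset_fold h A + A"
    using x(2) by (auto intro: set_plus_intro)
next
  fix z assume "z \<in> sumset_fold h A + A"
  then obtain x b where x: "\<forall>i\<in>{1..h}. x i \<in> A" and b: "b \<in> A"
    and z: "z = (\<Sum>i=1..h. x i) + b"
    by (auto simp: sumset_fold_def elim!: set_plus_elim)
  let ?y = "x(Suc h := b)"
  have "(\<Sum>i=1..h. ?y i) = (\<Sum>i=1..h. x i)" by (rule sum.cong) auto
  then have "z = (\<Sum>i=1..Suc h. ?y i)" using z by simp
  moreover have "\<forall>i\<in>{1..Suc h}. ?y i \<in> A" using x b by auto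
  ultimately show "z \<in> sumset_fold (Suc h) A" unfolding sumset_fold_def by blast
qed

lemma sumset_fold_add: "sumset_fold (h + k) A = sumset_fold h A + sumset_fold k A"
proof (induction k)
  case 0
  show ?case by (simp add: set_zero)
next
  case (Suc k)
  then show ?case by (simp add: sumset_fold_Suc add.assoc)
qed

lemma sumset_fold_mult: "sumset_fold r (sumset_fold h A) = sumset_fold (r * h) A"
proof (induction r)
  case 0
  show ?case by simp
next
  case (Suc r)
  have "sumset_fold (Suc r) (sumset_fold h A) = sumset_fold (r * h + h) A"
    by (simp only: sumset_fold_Suc Suc sumset_fold_add)
  then show ?case by (simp add: add.commute)
qed

lemma sumset_fold_affine:
  "sumset_fold h ((\<lambda>b. p + q * b) ` B) = (\<lambda>s. int h * p + q * s) ` sumset_fold h B"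
proof (induction h)
  case 0
  show ?case by simp
next
  case (Suc h)
  have "(\<lambda>s. int h * p + q * s) ` sumset_fold h B + (\<lambda>b. p + q * b) ` B
      = (\<lambda>s. int (Suc h) * p + q * s) ` (sumset_fold h B + B)" (is "?L = ?R")
  proof (intro equalityI subsetI)
    fix z assume "z \<in> ?L"
    then obtain s b where sb: "s \<in> sumset_fold h B" "b \<in> B"
      and "z = (int h * p + q * s) + (p + q * b)"
      by (auto elim!: set_plus_elim)
    then have "z = int (Suc h) * p + q * (s + b)" by (simp add: algebra_simps)
    then show "z \<in> ?R" using sb by (auto intro: set_plus_intro)
  next
    fix z assume "z \<in> ?R"
    then obtain s b where sb: "s \<in> sumset_fold h B" "b \<in> B"
      and "z = int (Suc h) * p + q * (s + b)"
      by (auto elim!: set_plus_elim)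
    then have "z = (int h * p + q * s) + (p + q * b)" by (simp add: algebra_simps)
    then show "z \<in> ?L" using sb by (auto intro: set_plus_intro)
  qed
  then show ?case by (simp only: sumset_fold_Suc Suc)
qed

lemma sumset_fold_mono:
  assumes "0 \<in> A" "h \<le> k"
  shows "sumset_fold h A \<subseteq> sumset_fold k A"
  using assms(2)
proof (induction k rule: dec_induct)
  case base
  show ?case by simp
next
  case (step k)
  have "sumset_fold k A \<subseteq> sumset_fold (Suc k) A"
    using set_plus_intro[OF _ assms(1)] by (fastforce simp: sumset_fold_Suc)
  with step.IH show ?case by blast
qed

lemma sumset_fold_bounds:
  assumes "B \<subseteq> {0..N}"
  shows "sumset_fold h B \<subseteq> {0..int h * N}"
proof (induction h)
  case 0
  show ?case by simp
next
  case (Suc h)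
  show ?case
  proof
    fix z assume "z \<in> sumset_fold (Suc h) B"
    then obtain s b where "s \<in> sumset_fold h B" "b \<in> B" "z = s + b"
      by (auto simp: sumset_fold_Suc elim!: set_plus_elim)
    with Suc assms have "0 \<le> s" "s \<le> int h * N" "0 \<le> b" "b \<le> N" by auto
    then show "z \<in> {0..int (Suc h) * N}"
      using \<open>z = s + b\<close> by (simp add: algebra_simps)
  qed
qed

lemma multiple_in_sumset_fold: "b \<in> B \<Longrightarrow> int h * b \<in> sumset_fold h B"
proof (induction h)
  case 0
  show ?case by simp
next
  case (Suc h)
  then have "int h * b + b \<in> sumset_fold h B + B" by (intro set_plus_intro) auto
  then show ?case by (simp add: sumset_fold_Suc algebra_simps)
qed

text \<open>A sum of nonnegative integers equals 1 only if 1 is one of the summands.\<close>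

lemma one_notin_sumset_fold:
  assumes "B \<subseteq> {0..N}" "1 \<notin> B"
  shows "1 \<notin> sumset_fold h B"
proof (induction h)
  case 0
  show ?case by simp
next
  case (Suc h)
  show ?case
  proof
    assume "1 \<in> sumset_fold (Suc h) B"
    then obtain s b where sb: "s \<in> sumset_fold h B" "b \<in> B" "1 = s + b"
      by (auto simp: sumset_fold_Suc elim!: set_plus_elim)
    have "0 \<le> s" "0 \<le> b" using sb sumset_fold_bounds[OF assms(1), of h] assms(1) by auto
    with sb(3) have "s = 1 \<or> b = 1" by linarith
    with sb Suc assms(2) show False by auto
  qed
qed

section \<open>Large sumsets contain long intervals\<close>

lemma Gcd_mem_of_closed:
  fixes V F :: "int set"
  assumes "finite F" "F \<subseteq> V" "0 \<in> V"
    and plus: "\<And>x y. x \<in> V \<Longrightarrow> y \<in> V \<Longrightarrow> x + y \<in> V"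
    and minus: "\<And>x. x \<in> V \<Longrightarrow> - x \<in> V"
  shows "Gcd F \<in> V"
proof -
  have nat_mult: "int n * x \<in> V" if "x \<in> V" for n x
    using that by (induction n) (auto simp: assms(3) distrib_right intro: plus)
  have mult: "u * x \<in> V" if "x \<in> V" for u x
    using nat_mult[OF that, of "nat u"] minus[OF nat_mult[OF that, of "nat (- u)"]]
    by (cases "u \<ge> 0") auto
  have gcd: "gcd x y \<in> V" if "x \<in> V" "y \<in> V" for x y
  proof -
    obtain u v where "u * x + v * y = gcd x y" using bezout_int by blast
    then show ?thesis using plus[OF mult[OF that(1)] mult[OF that(2)], of u v] by simp
  qed
  show ?thesis
    using assms(1,2) by (induction F) (auto simp: assms(3) intro: gcd)
qed

text \<open>
  The residues modulo \<open>N\<close> of elements of the sumsets form a subgroup of the residues: \<open>(N - 1) s\<close>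
  lies in a higher sumset and represents \<open>- s\<close>. This subgroup contains \<open>Gcd B\<close>. Because \<open>0 \<in> B\<close>,
  the sumsets increase with \<open>h\<close>, so a single one meets all of the finitely many residue classes.
\<close>

lemma sumset_fold_all_residues:
  fixes B :: "int set"
  assumes "finite B" "0 \<in> B" "Gcd B = 1" "N > 0"
  shows "\<exists>k. \<forall>z. \<exists>s\<in>sumset_fold k B. s mod N = z mod N"
proof -
  define V where "V = {z. \<exists>k. \<exists>s\<in>sumset_fold k B. s mod N = z mod N}"
  have VI: "z \<in> V" if "s \<in> sumset_fold k B" "s mod N = z mod N" for s z k
    using that unfolding V_def by blast
  have B: "B \<subseteq> V"
    using multiple_in_sumset_fold[of _ B 1] by (force intro: VI)
  have plus: "x + y \<in> V" if xy: "x \<in> V" "y \<in> V" for x y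
  proof -
    obtain k s k' s' where s: "s \<in> sumset_fold k B" "s mod N = x mod N"
      "s' \<in> sumset_fold k' B" "s' mod N = y mod N"
      using xy by (auto simp: V_def)
    have "s + s' \<in> sumset_fold (k + k') B"
      using s by (simp add: sumset_fold_add set_plus_intro)
    moreover have "(s + s') mod N = (x + y) mod N" using s by (metis mod_add_cong)
    ultimately show ?thesis by (rule VI)
  qed
  have minus: "- x \<in> V" if x: "x \<in> V" for x
  proof -
    obtain k s where s: "s \<in> sumset_fold k B" "s mod N = x mod N"
      using x by (auto simp: V_def)
    have "int (nat (N - 1)) * s \<in> sumset_fold (nat (N - 1) * k) B"
      using multiple_in_sumset_fold[OF s(1)] by (simp only: sumset_fold_mult)
    moreover have "(int (nat (N - 1)) * s) mod N = (- x) mod N"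
    proof -
      have "int (nat (N - 1)) * s = - s + N * s" using assms(4) by (simp add: algebra_simps)
      then have "(int (nat (N - 1)) * s) mod N = (- s) mod N" by (simp only: mod_mult_self2)
      also have "\<dots> = (- x) mod N" using s(2) by (metis mod_minus_cong)
      finally show ?thesis .
    qed
    ultimately show ?thesis by (rule VI)
  qed
  have "1 \<in> V"
    using Gcd_mem_of_closed[OF assms(1) B _ plus minus] B assms(2,3) by auto
  have nat_in: "int i \<in> V" for i
  proof (induction i)
    case 0
    show ?case using B assms(2) by auto
  next
    case (Suc i)
    then show ?case using plus[OF Suc \<open>1 \<in> V\<close>] by (simp add: algebra_simps)
  qed
  have "\<forall>i\<in>{..<nat N}. \<exists>k. \<exists>s\<in>sumset_fold k B. s mod N = int i mod N"
    using nat_in unfolding V_def mem_Collect_eq by (intro ballI)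
  from bchoice[OF this]
  obtain K where K: "\<forall>i\<in>{..<nat N}. \<exists>s\<in>sumset_fold (K i) B. s mod N = int i mod N" ..
  define k where "k = Max (K ` {..<nat N})"
  have "\<exists>s\<in>sumset_fold k B. s mod N = z mod N" for z
  proof -
    let ?i = "nat (z mod N)"
    have i: "?i \<in> {..<nat N}" "int ?i = z mod N" using assms(4) by simp_all
    obtain s where s: "s \<in> sumset_fold (K ?i) B" "s mod N = int ?i mod N" using K i(1) by blast
    have "K ?i \<le> k" unfolding k_def using i(1) by (intro Max_ge) auto
    then have "s \<in> sumset_fold k B" using sumset_fold_mono[OF assms(2)] s(1) by blast
    moreover have "s mod N = z mod N" using s(2) unfolding i(2) by (simp only: mod_mod_trivial)
    ultimately show ?thesis by (rule bexI[rotated])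
  qed
  then show ?thesis by blast
qed

text \<open>
  From a representative of its residue class in \<open>kB\<close>, a number \<open>z\<close> is reached by adding copies of
  \<open>N \<in> B\<close>. Representatives lie in \<open>{0..kN}\<close>, so the number of copies is nonnegative once
  \<open>z \<ge> kN\<close>, and at most \<open>h - k\<close> as long as \<open>z \<le> (h - k) N\<close>.
\<close>

lemma sumset_fold_contains_interval:
  fixes B :: "int set"
  assumes B: "B \<subseteq> {0..N}" "0 \<in> B" "N \<in> B" "Gcd B = 1" and "N > 0"
  obtains k :: nat where
    "\<And>h. {int k * N..int h * N - int k * N} \<subseteq> sumset_fold h B"
proof -
  have "finite B" using B(1) finite_subset by blast
  then obtain k where k: "\<And>z. \<exists>s\<in>sumset_fold k B. s mod N = z mod N"
    using sumset_fold_all_residues assms by blast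
  have "z \<in> sumset_fold h B" if z: "int k * N \<le> z" "z \<le> int h * N - int k * N" for h z
  proof -
    obtain s where s: "s \<in> sumset_fold k B" "s mod N = z mod N" using k by blast
    have sb: "0 \<le> s" "s \<le> int k * N" using s(1) sumset_fold_bounds[OF B(1), of k] by auto
    have "N dvd z - s" using s(2) by (metis mod_eq_dvd_iff)
    then obtain j where j: "z - s = N * j" by blast
    have "0 \<le> N * j" using j sb z by linarith
    then have j0: "0 \<le> j" using \<open>N > 0\<close> by (simp add: zero_le_mult_iff)
    have "N * j \<le> N * (int h - int k)" using j sb z by (simp add: algebra_simps)
    then have j1: "j \<le> int h - int k" using \<open>N > 0\<close> by simp
    have "s + int (nat j) * N \<in> sumset_fold (k + nat j) B"
      unfolding sumset_fold_add
      by (intro set_plus_intro s(1) multiple_in_sumset_fold B(3))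
    then have "z \<in> sumset_fold (k + nat j) B" using j j0 by (simp add: algebra_simps)
    moreover have "k + nat j \<le> h" using j0 j1 by linarith
    ultimately show ?thesis using sumset_fold_mono[OF B(2)] by blast
  qed
  then show ?thesis by (intro that) auto
qed

section \<open>Covering by translates of a set with a hole\<close>

text \<open>
  The right end of what \<open>n\<close> translates of a set \<open>S\<close> with a hole at 1 can cover. Let \<open>x\<close> be the
  largest translation. The hole \<open>x + 1\<close> and everything to the left of \<open>x\<close> must be covered by the
  other \<open>n - 1\<close> translates, to which induction applies, while \<open>y \<le> x + M\<close>. The set to be covered is
  an interval \<open>{c..y - e}\<close> together with the isolated points \<open>0\<close> and \<open>y\<close>. This shape serves two
  purposes: it is inherited by the remaining translates, with \<open>x + 1\<close> as the new isolated point
  (whence \<open>e \<ge> 2\<close>), and it allows for a bounded irregularity at both ends.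
\<close>

lemma cover_by_punctured_translates:
  fixes S X :: "int set"
  assumes S: "S \<subseteq> {0..M} - {1}" and c: "2 \<le> c" "c \<le> M" and e: "2 \<le> e" "e + 2 \<le> M"
  shows "1 \<le> n \<Longrightarrow> finite X \<Longrightarrow> card X \<le> n \<Longrightarrow> insert 0 (insert y {c..y - e}) \<subseteq> S + X
    \<Longrightarrow> y \<le> int n * (M - 1) + 1"
proof (induction n arbitrary: X y rule: nat_induct_at_least)
  case base
  have "X \<noteq> {}" using base(3) by (auto simp: set_plus_def)
  then have "card X = 1" using base(1,2) by (simp add: le_Suc_eq)
  then obtain x where "X = {x}" by (rule card_1_singletonE)
  with base(3) S have "x \<le> 0" "y \<le> x + M" by (auto elim!: set_plus_elim)
  then show ?case by simp
next
  case (Suc k)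
  note cov = \<open>insert 0 (insert y {c..y - e}) \<subseteq> S + X\<close>
  have k: "int k * (M - 1) \<ge> M - 1"
    using mult_right_mono[of 1 "int k" "M - 1"] Suc.hyps e by simp
  have "X \<noteq> {}" using cov by (auto simp: set_plus_def)
  define x where "x = Max X"
  have xX: "x \<in> X" and xmax: "\<And>u. u \<in> X \<Longrightarrow> u \<le> x"
    using \<open>finite X\<close> \<open>X \<noteq> {}\<close> by (auto simp: x_def)
  let ?X = "X - {x}"
  have X': "finite ?X" "card ?X \<le> k"
    using Suc.prems(1,2) xX by auto
  have yx: "y \<le> x + M"
  proof -
    have "y \<in> S + X" using cov by auto
    then obtain s u where "s \<in> S" "u \<in> X" "y = s + u" by (auto elim!: set_plus_elim)
    then show ?thesis using xmax[of u] S by fastforce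
  qed
  have rest: "z \<in> S + ?X" if z: "z \<in> S + X" "z < x \<or> z = x + 1" for z
  proof -
    obtain s u where su: "s \<in> S" "u \<in> X" "z = s + u" using z(1) by (auto elim!: set_plus_elim)
    have "u \<noteq> x" using su z(2) S by auto
    then show ?thesis using su by (auto intro: set_plus_intro)
  qed
  consider (left) "x + 1 < c" | (mid) "c \<le> x + 1" "x + 1 \<le> y - e"
    | (short) "y < c + e + 1" | (right) "y - e \<le> x" "c + e + 1 \<le> y"
    by linarith
  then show ?case
  proof cases
    case left
    then show ?thesis using yx k c by (simp add: algebra_simps)
  next
    case mid
    have "insert 0 (insert (x + 1) {c..x + 1 - e}) \<subseteq> S + ?X"
      using cov mid c e by (auto intro!: rest)
    from Suc.IH[OF X' this] show ?thesis using yx by (simp add: algebra_simps)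
  next
    case short
    then show ?thesis using k c e by (simp add: algebra_simps)
  next
    \<comment> \<open>The largest translate contributes only the last \<open>e\<close> places, so a cut at \<open>y - e - 1\<close> suffices.\<close>
    case right
    have "insert 0 (insert (y - e - 1) {c..y - e - 1 - e}) \<subseteq> S + ?X"
      using cov right c e by (auto intro!: rest)
    from Suc.IH[OF X' this] show ?thesis using e by (simp add: algebra_simps)
  qed
qed

lemma card_set_plus_le:
  assumes "finite S" "finite X"
  shows "card (S + X) \<le> card S * card X"
proof -
  have "card ((\<lambda>(s, x). s + x) ` (S \<times> X)) \<le> card (S \<times> X)"
    using assms by (intro card_image_le) auto
  then show ?thesis by (simp add: set_plus_image card_cartesian_product)
qed

section \<open>Approximate groups in normalised form\<close>

text \<open>
  The \<open>h\<close>-fold and the \<open>rh\<close>-fold sumsets of \<open>p + qB\<close> each lie in a single residue class modulo \<open>q\<close>.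
  Hence a translation by which the first meets the second is, up to a fixed shift, a multiple
  of \<open>q\<close>, and its quotient by \<open>q\<close> does the same job for \<open>B\<close>. The other elements of \<open>X\<close> cover
  nothing, so it does no harm to round their quotients down; since quotients may coincide, only
  \<open>card X \<le> l\<close> survives.
\<close>

lemma approximate_group_affine_cover:
  fixes B :: "int set"
  assumes "approximate_group r l (sumset_fold h ((\<lambda>b. p + q * b) ` B))" "q \<noteq> 0"
  obtains X where "finite X" "card X \<le> l" "sumset_fold (r * h) B \<subseteq> sumset_fold h B + X"
proof -
  let ?A = "(\<lambda>b. p + q * b) ` B"
  obtain X where X: "finite X" "card X = l"
    "sumset_fold (r * h) ?A \<subseteq> sumset_fold h ?A + X"
    using assms(1) unfolding approximate_group_def sumset_fold_mult by blast
  let ?f = "\<lambda>x. (x + int h * p - int (r * h) * p) div q"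
  have "u \<in> sumset_fold h B + ?f ` X" if u: "u \<in> sumset_fold (r * h) B" for u
  proof -
    have "int (r * h) * p + q * u \<in> sumset_fold (r * h) ?A"
      using u unfolding sumset_fold_affine by blast
    then have "int (r * h) * p + q * u \<in> sumset_fold h ?A + X" using X(3) by blast
    then obtain s x where s: "s \<in> sumset_fold h B" "x \<in> X"
      "int (r * h) * p + q * u = int h * p + q * s + x"
      unfolding sumset_fold_affine by (auto elim!: set_plus_elim)
    then have "x + int h * p - int (r * h) * p = q * (u - s)" by (simp add: algebra_simps)
    then have "?f x = u - s" using assms(2) by simp
    then have "u = s + ?f x" by simp
    then show ?thesis using set_plus_intro[OF s(1) imageI[OF s(2), of ?f]] by argo
  qed
  moreover have "card (?f ` X) \<le> l" using X(1,2) card_image_le by blast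
  ultimately show ?thesis using X(1) by (intro that[of "?f ` X"]) auto
qed

text \<open>
  Both conclusions in normalised form. The step \<open>q\<close> may be negative, so that this applies to a set
  and, for its other end, to the reflected description of the same set.
\<close>

lemma asymptotic_approximate_group_affine:
  fixes B :: "int set" and r l :: nat
  assumes B: "B \<subseteq> {0..N}" "0 \<in> B" "N \<in> B" "Gcd B = 1" and N: "N > 0" and q: "q \<noteq> 0"
    and r: "r \<ge> 2"
    and asym: "asymptotic_approximate_group r l ((\<lambda>b. p + q * b) ` B)"
  shows "r \<le> l" and "l = r \<Longrightarrow> 1 \<in> B"
proof -
  obtain h0 where h0: "\<And>h. h \<ge> h0 \<Longrightarrow> h > 0 \<Longrightarrow>
      approximate_group r l (sumset_fold h ((\<lambda>b. p + q * b) ` B))"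
    using asym unfolding asymptotic_approximate_group_def by blast
  obtain k where k: "\<And>h. {int k * N..int h * N - int k * N} \<subseteq> sumset_fold h B"
    using sumset_fold_contains_interval[OF B N] by blast
  define c where "c = int k * N + 2"
  have c: "c \<ge> 2" using N by (simp add: c_def)
  \<comment> \<open>Large enough for \<open>M = hN\<close> to exceed the thresholds \<open>2 c + r\<close> and \<open>c + 2\<close> used below.\<close>
  define h where "h = h0 + nat (2 * c) + r + 2"
  define M where "M = int h * N"
  have "int h * 1 \<le> M" unfolding M_def using N by (intro mult_left_mono) auto
  then have M: "2 * c + int r + 2 \<le> M" using c by (simp add: h_def)
  obtain X where X: "finite X" "card X \<le> l" "sumset_fold (r * h) B \<subseteq> sumset_fold h B + X"
    using approximate_group_affine_cover[OF h0 q, of h] by (auto simp: h_def)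
  have S: "sumset_fold h B \<subseteq> {0..M}" unfolding M_def by (rule sumset_fold_bounds[OF B(1)])
  have rM: "int (r * h) * N = int r * M" by (simp add: M_def)
  have mid: "{c..int r * M - c} \<subseteq> sumset_fold (r * h) B"
    using k[of "r * h"] unfolding rM c_def by fastforce
  show "r \<le> l"
  proof (rule ccontr)
    assume "\<not> r \<le> l"
    have fin: "finite (sumset_fold h B)" using S finite_subset by blast
    have "int r * M - 2 * c + 1 \<le> int (card {c..int r * M - c})" by simp
    also have "card {c..int r * M - c} \<le> card (sumset_fold h B + X)"
      using mid X(1,3) fin by (intro card_mono finite_set_plus) auto
    also have "\<dots> \<le> card (sumset_fold h B) * card X"
      by (rule card_set_plus_le[OF fin X(1)])
    also have "\<dots> \<le> card {0..M} * (r - 1)"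
      using S X(2) \<open>\<not> r \<le> l\<close> by (intro mult_mono card_mono) auto
    finally have "int r * M - 2 * c + 1 \<le> (M + 1) * (int r - 1)"
      using M c r by (simp add: of_nat_diff)
    then show False using M by (simp add: algebra_simps)
  qed
  show "1 \<in> B" if "l = r"
  proof (rule ccontr)
    assume "1 \<notin> B"
    then have S1: "sumset_fold h B \<subseteq> {0..M} - {1}"
      using S one_notin_sumset_fold[OF B(1)] by auto
    have "insert 0 (insert (int r * M) {c..int r * M - c}) \<subseteq> sumset_fold (r * h) B"
      using mid multiple_in_sumset_fold[OF B(2), of "r * h"]
        multiple_in_sumset_fold[OF B(3), of "r * h", unfolded rM] by simp
    then have "insert 0 (insert (int r * M) {c..int r * M - c}) \<subseteq> sumset_fold h B + X"
      using X(3) by blast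
    then have "int r * M \<le> int r * (M - 1) + 1"
      using cover_by_punctured_translates[OF S1, of c c r X] X(1,2) that r c M by simp
    then show False using r by (simp add: algebra_simps)
  qed
qed

section \<open>The theorem\<close>

theorem theorem2:
  fixes r l m :: nat and a :: "nat \<Rightarrow> int" and A :: "int set" and d :: int
  assumes "r \<ge> 2" and "l > 0" and "m \<ge> 2"
    and "strict_mono_on {1..m} a"
    and "A = a ` {1..m}"
    and "d = Gcd ((\<lambda>i. a i - a 1) ` {2..m})"
  shows "(asymptotic_approximate_group r l A \<longrightarrow> l \<ge> r) \<and>
         (asymptotic_approximate_group r r A \<longrightarrow> a 2 = a 1 + d \<and> a m = a (m - 1) + d)"
proof -
  have less: "a i < a j" if "1 \<le> i" "i < j" "j \<le> m" for i j
    using strict_mono_onD[OF assms(4)] that by simp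
  have le: "a i \<le> a j" if "1 \<le> i" "i \<le> j" "j \<le> m" for i j
    using less[of i j] that by (cases "i = j") auto
  have dvd: "d dvd a i - a 1" if "i \<in> {1..m}" for i
  proof (cases "i = 1")
    case False
    then show ?thesis using that unfolding assms(6) by (intro Gcd_dvd) auto
  qed simp
  have "d \<noteq> 0" using dvd[of 2] less[of 1 2] assms(3) by auto
  then have d: "d > 0" using Gcd_int_greater_eq_0[of "(\<lambda>i. a i - a 1) ` {2..m}"] assms(6) by linarith
  define B where "B = (\<lambda>i. (a i - a 1) div d) ` {1..m}"
  define N where "N = (a m - a 1) div d"
  have db: "d * ((a i - a 1) div d) = a i - a 1" if "i \<in> {1..m}" for i
    using dvd[OF that] by simp
  have dN: "d * N = a m - a 1" using db[of m] assms(3) by (simp add: N_def)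
  have B0: "0 \<in> B" unfolding B_def by (rule image_eqI[of _ _ 1]) (use assms(3) in auto)
  have BN: "N \<in> B" unfolding B_def N_def using assms(3) by auto
  have BB: "B \<subseteq> {0..N}"
    unfolding B_def N_def using le d by (auto intro!: zdiv_mono1 simp: pos_imp_zdiv_nonneg_iff)
  have "d * N > 0" unfolding dN using less[of 1 m] assms(3) by simp
  then have N: "N > 0" using d by (simp add: zero_less_mult_iff)
  have A1: "A = (\<lambda>b. a 1 + d * b) ` B"
    unfolding assms(5) B_def image_image
  proof (rule image_cong)
    fix i assume "i \<in> {1..m}"
    from db[OF this] show "a i = a 1 + d * ((a i - a 1) div d)" by linarith
  qed simp
  have GB: "Gcd B = 1"
  proof -
    have "d * Gcd B dvd a i - a 1" if "i \<in> {1..m}" for i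
    proof -
      have "Gcd B dvd (a i - a 1) div d" using that by (intro Gcd_dvd) (auto simp: B_def)
      then have "d * Gcd B dvd d * ((a i - a 1) div d)" by (rule mult_dvd_mono[OF dvd_refl])
      then show ?thesis unfolding db[OF that] .
    qed
    then have "d * Gcd B dvd Gcd ((\<lambda>i. a i - a 1) ` {2..m})" by (intro Gcd_greatest) auto
    then have "d * Gcd B dvd d * 1" unfolding assms(6)[symmetric] by simp
    then have "Gcd B dvd 1" using \<open>d \<noteq> 0\<close> by (simp only: dvd_mult_cancel_left) simp
    then show ?thesis using Gcd_int_greater_eq_0[of B] by simp
  qed
  define B' where "B' = (\<lambda>b. N - b) ` B"
  have B': "B' \<subseteq> {0..N}" "0 \<in> B'" "N \<in> B'"
    using BB B0 BN by (auto simp: B'_def image_iff)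
  have GB': "Gcd B' = 1"
  proof -
    have "Gcd B' dvd b" if "b \<in> B" for b
    proof -
      have "Gcd B' dvd N" "Gcd B' dvd N - b"
        using B'(3) that by (auto simp: B'_def intro!: Gcd_dvd)
      then have "Gcd B' dvd N - (N - b)" by (rule dvd_diff)
      then show ?thesis by simp
    qed
    then have "Gcd B' dvd Gcd B" by (rule Gcd_greatest)
    then show ?thesis using GB Gcd_int_greater_eq_0[of B'] by simp
  qed
  have A2: "A = (\<lambda>b. a m + (- d) * b) ` B'"
    unfolding A1 B'_def image_image
  proof (rule image_cong)
    fix b
    have "a m = a 1 + d * N" using dN by simp
    then show "a 1 + d * b = a m + - d * (N - b)" by (simp add: algebra_simps)
  qed simp
  have "r \<le> l" if "asymptotic_approximate_group r l A"
    using asymptotic_approximate_group_affine(1)[OF BB B0 BN GB N \<open>d \<noteq> 0\<close> assms(1)] that A1 by auto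
  moreover have "a 2 = a 1 + d \<and> a m = a (m - 1) + d" if asym: "asymptotic_approximate_group r r A"
  proof
    have "1 \<in> B"
      using asymptotic_approximate_group_affine(2)[OF BB B0 BN GB N \<open>d \<noteq> 0\<close> assms(1)] asym A1 by auto
    then have "a 1 + d \<in> A" unfolding A1 by (intro image_eqI[of _ _ 1]) auto
    then obtain i where i: "i \<in> {1..m}" "a i = a 1 + d" using assms(5) by auto
    then have "i \<noteq> 1" using d by auto
    then have "a 2 \<le> a 1 + d" using le[of 2 i] i by auto
    moreover have "d \<le> a 2 - a 1"
      using dvd[of 2] less[of 1 2] assms(3) by (intro zdvd_imp_le) auto
    ultimately show "a 2 = a 1 + d" by simp
  next
    have "1 \<in> B'"
      using asymptotic_approximate_group_affine(2)[OF B' GB' N _ assms(1) asym[unfolded A2] refl] \<open>d \<noteq> 0\<close>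
      by simp
    then have "a m - d \<in> A" unfolding A2 by (intro image_eqI[of _ _ 1]) auto
    then obtain i where i: "i \<in> {1..m}" "a i = a m - d" using assms(5) by auto
    then have "i \<noteq> m" using d by auto
    then have "a m - d \<le> a (m - 1)" using le[of i "m - 1"] i by auto
    moreover have "d \<le> a m - a (m - 1)"
    proof (rule zdvd_imp_le)
      have "d dvd (a m - a 1) - (a (m - 1) - a 1)"
        using assms(3) by (intro dvd_diff dvd) auto
      then show "d dvd a m - a (m - 1)" by simp
      show "0 < a m - a (m - 1)" using less[of "m - 1" m] assms(3) by simp
    qed
    ultimately show "a m = a (m - 1) + d" by simp
  qed
  ultimately show ?thesis by blast
qed

end
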